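(* Consider a ball of radius $R>0$ with uniform mass distribution moving in $\mathbb{R}^3$ in the region between two fixed parallel planes and undergoing no-slip collisions with these planes. Then every orbit for which the component of the velocity of the center perpendicular to the planes is nonzero is bounded; that is, the position of the center of the ball stays in a bounded subset of $\mathbb{R}^3$ for all time.
   Context: Let $m$ be the mass of the ball, $u\in\mathbb{R}^3$ the velocity of its center and $\omega\in\mathbb{R}^3$ its angular velocity vector. The moment of inertia about any axis through the center is $\tfrac25 mR^2$, and the kinetic energy is $\tfrac12 m|u|^2+\tfrac15 mR^2|\omega|^2$. The distance between the planes is greater than $2R$, so that the center moves in a slab of positive width. Between collisions $u$ and $\omega$ are constant and the center moves along a straight line at constant speed. No-slip collision: suppose the ball touches a plane whose unit normal pointing into the region is $\nu$. The contact point on the ball is $-R\nu$ relative to the center and has velocity $c=u+\omega\times(-R\nu)$. In a no-slip collision an impulse $J\in\mathbb{R}^3$ is applied to the ball at the contact point only, so that $u^+=u^-+\tfrac1m J$ and $\tfrac25mR^2(\omega^+-\omega^-)=(-R\nu)\times J$, where $J$ is the unique vector for which the velocity of the contact point is exactly reversed, $c^+=-c^-$. This map is linear, involutive and preserves kinetic energy. The normal component of $u$ only changes sign at collisions. *)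

theory Defs
  imports "HOL-Analysis.Analysis"
begin

text \<open>
  A homogeneous ball of mass \<open>m\<close> and radius \<open>R\<close>; \<open>u\<close> is the velocity of its center and \<open>w\<close> its
  angular velocity vector. \<open>\<nu>\<close> is the unit normal of a wall, pointing into the region, so that
  the point of the ball in contact with the wall is \<open>- R \<nu>\<close> relative to the center.
\<close>

definition moment_of_inertia :: "real \<Rightarrow> real \<Rightarrow> real" where
  "moment_of_inertia m R = 2/5 * m * R\<^sup>2"

definition contact_velocity :: "real \<Rightarrow> real^3 \<Rightarrow> real^3 \<Rightarrow> real^3 \<Rightarrow> real^3" where
  "contact_velocity R \<nu> u w = u + cross3 w (- (R *\<^sub>R \<nu>))"

definition no_slip_impulse ::
  "real \<Rightarrow> real \<Rightarrow> real^3 \<Rightarrow> real^3 \<Rightarrow> real^3 \<Rightarrow> real^3 \<Rightarrow> real^3 \<Rightarrow> real^3 \<Rightarrow> bool" where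
  "no_slip_impulse m R \<nu> J u w u' w' \<longleftrightarrow>
     u' = u + (1/m) *\<^sub>R J \<and>
     moment_of_inertia m R *\<^sub>R (w' - w) = cross3 (- (R *\<^sub>R \<nu>)) J \<and>
     contact_velocity R \<nu> u' w' = - contact_velocity R \<nu> u w"

definition no_slip_collision ::
  "real \<Rightarrow> real \<Rightarrow> real^3 \<Rightarrow> real^3 \<Rightarrow> real^3 \<Rightarrow> real^3 \<Rightarrow> real^3 \<Rightarrow> bool" where
  "no_slip_collision m R \<nu> u w u' w' \<longleftrightarrow> (\<exists>J. no_slip_impulse m R \<nu> J u w u' w')"

text \<open>The impulse is unique, so \<open>no_slip_collision\<close> is the graph of a function.\<close>

lemma no_slip_impulse_ex1:
  assumes "m > 0" "R > 0" "norm \<nu> = 1"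
  shows "\<exists>!(J, u', w'). no_slip_impulse m R \<nu> J u w u' w'"
proof -
  have nn: "\<nu> \<bullet> \<nu> = 1"
    using assms(3) by (simp add: dot_square_norm)
  define c where "c = contact_velocity R \<nu> u w"
  have I: "moment_of_inertia m R \<noteq> 0"
    using assms by (simp add: moment_of_inertia_def)
  have w'_iff: "moment_of_inertia m R *\<^sub>R (w' - w) = cross3 (- (R *\<^sub>R \<nu>)) J \<longleftrightarrow>
        w' = w + (1 / moment_of_inertia m R) *\<^sub>R cross3 (- (R *\<^sub>R \<nu>)) J" for w' J
  proof -
    have "k *\<^sub>R (w' - w) = y \<longleftrightarrow> w' = w + (1 / k) *\<^sub>R y" if "k \<noteq> 0" for k and y :: "real^3"
    proof
      assume "k *\<^sub>R (w' - w) = y"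
      then have "y = k *\<^sub>R (w' - w)" ..
      then show "w' = w + (1 / k) *\<^sub>R y" using that by simp
    next
      assume "w' = w + (1 / k) *\<^sub>R y"
      then show "k *\<^sub>R (w' - w) = y" using that by simp
    qed
    then show ?thesis using I by blast
  qed
  have change: "contact_velocity R \<nu> (u + (1/m) *\<^sub>R J)
          (w + (1 / moment_of_inertia m R) *\<^sub>R cross3 (- (R *\<^sub>R \<nu>)) J)
        = c + (7 / (2*m)) *\<^sub>R J - (5 / (2*m) * (\<nu> \<bullet> J)) *\<^sub>R \<nu>" for J
  proof -
    have "cross3 (cross3 \<nu> J) \<nu> = - cross3 \<nu> (cross3 \<nu> J)"
      by (rule cross_skew)
    also have "\<dots> = J - (\<nu> \<bullet> J) *\<^sub>R \<nu>"
      by (simp add: Lagrange nn)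
    finally have double: "cross3 (cross3 \<nu> J) \<nu> = J - (\<nu> \<bullet> J) *\<^sub>R \<nu>" .
    have coeff: "R * R / moment_of_inertia m R = 5 / (2*m)"
      using assms by (simp add: moment_of_inertia_def field_simps power2_eq_square)
    have "contact_velocity R \<nu> (u + (1/m) *\<^sub>R J)
          (w + (1 / moment_of_inertia m R) *\<^sub>R cross3 (- (R *\<^sub>R \<nu>)) J)
        = c + (1/m) *\<^sub>R J + (R * R / moment_of_inertia m R) *\<^sub>R cross3 (cross3 \<nu> J) \<nu>"
      by (simp add: contact_velocity_def c_def cross_add_left cross_mult_left cross_mult_right
          cross_minus_left cross_minus_right Cross3.left_diff_distrib scaleR_right_diff_distrib)
    also have "\<dots> = c + (1/m + 5 / (2*m)) *\<^sub>R J - (5 / (2*m) * (\<nu> \<bullet> J)) *\<^sub>R \<nu>"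
      by (simp only: coeff double scaleR_right_diff_distrib scaleR_left_distrib scaleR_scaleR)
        (simp only: add.assoc add_diff_eq)
    also have "1/m + 5 / (2*m) = 7 / (2*m)"
      using assms by (simp add: field_simps)
    finally show ?thesis .
  qed
  define J0 where "J0 = - ((4*m/7) *\<^sub>R c) - ((10*m/7) * (\<nu> \<bullet> c)) *\<^sub>R \<nu>"
  have normal_J0: "\<nu> \<bullet> J0 = - 2 * m * (\<nu> \<bullet> c)"
    by (simp add: J0_def inner_diff_right nn)
  have rev_iff: "c + (7 / (2*m)) *\<^sub>R J - (5 / (2*m) * (\<nu> \<bullet> J)) *\<^sub>R \<nu> = - c \<longleftrightarrow> J = J0" for J
  proof -
    have scalar: "ci + 7 / (2*m) * Ji - 5 / (2*m) * (- 2 * m * p) * ni = - ci \<longleftrightarrow>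
        Ji = - (4*m/7 * ci) - 10*m/7 * p * ni" for ci Ji p ni :: real
      using assms(1) by (simp add: divide_simps) argo
    have if_normal: "c + (7 / (2*m)) *\<^sub>R J - (5 / (2*m) * (\<nu> \<bullet> J)) *\<^sub>R \<nu> = - c \<longleftrightarrow> J = J0"
      if "\<nu> \<bullet> J = - 2 * m * (\<nu> \<bullet> c)"
      unfolding that J0_def vec_eq_iff vector_add_component vector_minus_component
        vector_uminus_component vector_scaleR_component real_scaleR_def scalar ..
    have "\<nu> \<bullet> J = - 2 * m * (\<nu> \<bullet> c)"
      if eq: "c + (7 / (2*m)) *\<^sub>R J - (5 / (2*m) * (\<nu> \<bullet> J)) *\<^sub>R \<nu> = - c"
    proof -
      have "\<nu> \<bullet> (c + (7 / (2*m)) *\<^sub>R J - (5 / (2*m) * (\<nu> \<bullet> J)) *\<^sub>R \<nu>) = \<nu> \<bullet> (- c)"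
        by (simp only: eq)
      then have "\<nu> \<bullet> c + 7 / (2*m) * (\<nu> \<bullet> J) - 5 / (2*m) * (\<nu> \<bullet> J) = - (\<nu> \<bullet> c)"
        by (simp add: inner_diff_right inner_add_right nn)
      moreover have "7 / (2*m) * p - 5 / (2*m) * p = p / m" for p
        by (simp add: field_simps flip: add_divide_distrib diff_divide_distrib)
      ultimately have "(\<nu> \<bullet> J) / m = - 2 * (\<nu> \<bullet> c)"
        by (smt (verit))
      then show ?thesis
        using assms(1) by (simp add: divide_eq_eq mult.commute mult.left_commute)
    qed
    then show ?thesis
      using if_normal normal_J0 by blast
  qed
  have iff: "no_slip_impulse m R \<nu> J u w u' w' \<longleftrightarrow>
      J = J0 \<and> u' = u + (1/m) *\<^sub>R J0 \<and>
      w' = w + (1 / moment_of_inertia m R) *\<^sub>R cross3 (- (R *\<^sub>R \<nu>)) J0" for J u' w'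
    unfolding no_slip_impulse_def w'_iff c_def [symmetric]
    using change [of J] rev_iff [of J] by auto
  show ?thesis
    unfolding iff by (auto simp: Ex1_def)
qed

definition plane :: "real^3 \<Rightarrow> real \<Rightarrow> (real^3) set" where
  "plane n a = {y. n \<bullet> y = a}"

definition region_between :: "real^3 \<Rightarrow> real \<Rightarrow> real \<Rightarrow> (real^3) set" where
  "region_between n a b = {y. a \<le> n \<bullet> y \<and> n \<bullet> y \<le> b}"

definition touches :: "real \<Rightarrow> real^3 \<Rightarrow> (real^3) set \<Rightarrow> real^3 \<Rightarrow> bool" where
  "touches R \<nu> P x \<longleftrightarrow> x - R *\<^sub>R \<nu> \<in> P"

text \<open>
  Motions defined for all times: \<open>x\<close> is the position of the center, \<open>u\<close> its velocity and \<open>w\<close> the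
  angular velocity. The first two predicates below describe the motion near a single time \<open>t\<close>.
  At a collision time the values \<open>u t\<close> and \<open>w t\<close> are irrelevant: the collision law relates the
  velocities \<open>u1, w1\<close> just before \<open>t\<close> to the velocities \<open>u2, w2\<close> just after \<open>t\<close>.
\<close>

definition free_motion_at ::
  "(real \<Rightarrow> real^3) \<Rightarrow> (real \<Rightarrow> real^3) \<Rightarrow> (real \<Rightarrow> real^3) \<Rightarrow> real \<Rightarrow> bool" where
  "free_motion_at x u w t \<longleftrightarrow>
     (\<forall>\<^sub>F s in nhds t. u s = u t \<and> w s = w t \<and> x s = x t + (s - t) *\<^sub>R u t)"

definition collision_at ::
  "real \<Rightarrow> real \<Rightarrow> real^3 \<Rightarrow> (real \<Rightarrow> real^3) \<Rightarrow> (real \<Rightarrow> real^3) \<Rightarrow> (real \<Rightarrow> real^3) \<Rightarrow> real \<Rightarrow> bool"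
  where
  "collision_at m R \<nu> x u w t \<longleftrightarrow>
     (\<exists>u1 w1 u2 w2.
        (\<forall>\<^sub>F s in at_left t. u s = u1 \<and> w s = w1 \<and> x s = x t + (s - t) *\<^sub>R u1) \<and>
        (\<forall>\<^sub>F s in at_right t. u s = u2 \<and> w s = w2 \<and> x s = x t + (s - t) *\<^sub>R u2) \<and>
        no_slip_collision m R \<nu> u1 w1 u2 w2)"

text \<open>
  The walls are \<open>plane n a\<close> and \<open>plane n b\<close> with \<open>a < b\<close>; their unit normals pointing into the
  region are \<open>n\<close> and \<open>- n\<close>.
\<close>

definition no_slip_orbit ::
  "real \<Rightarrow> real \<Rightarrow> real^3 \<Rightarrow> real \<Rightarrow> real \<Rightarrow>
   (real \<Rightarrow> real^3) \<Rightarrow> (real \<Rightarrow> real^3) \<Rightarrow> (real \<Rightarrow> real^3) \<Rightarrow> bool" where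
  "no_slip_orbit m R n a b x u w \<longleftrightarrow>
     (\<forall>t. cball (x t) R \<subseteq> region_between n a b) \<and>
     (\<forall>t. \<not> touches R n (plane n a) (x t) \<longrightarrow> \<not> touches R (- n) (plane n b) (x t) \<longrightarrow>
          free_motion_at x u w t) \<and>
     (\<forall>t. touches R n (plane n a) (x t) \<longrightarrow> collision_at m R n x u w t) \<and>
     (\<forall>t. touches R (- n) (plane n b) (x t) \<longrightarrow> collision_at m R (- n) x u w t)"

end

theory Submission
  imports Defs
begin

text \<open>
  Write \<open>v\<close> for the normal velocity, \<open>h\<close> for the height of the center above the midplane and \<open>L\<close>
  for the width of the slab in which the center moves. The contact velocity at the lower or upper
  wall is \<open>u \<plusminus> R (n \<times> w)\<close>, it is reversed together with \<open>v\<close>, and \<open>h = \<mp> L/2\<close> there. Hence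
  \<open>x - (h/v) u + (L/(2v)) R (n \<times> w)\<close> is a constant of motion. Since \<open>v\<^sup>2\<close> and the energy are
  conserved as well, \<open>x\<close> stays within a bounded distance of a fixed point. Multiplying by
  \<open>v\<^sup>2\<close> makes the conserved vector polynomial, so that it makes sense also for \<open>v = 0\<close>.
\<close>

section \<open>Local constancy on punctured neighbourhoods\<close>

text \<open>The value \<open>q t\<close> itself is left free because velocities at a collision time
  are arbitrary. The punctured limit value, as a function of \<open>t\<close>, is locally constant,
  and connectedness makes it globally constant.\<close>

lemma locally_constant_off_points_imp_constant:
  fixes q :: "'a :: {perfect_space, t1_space} \<Rightarrow> 'b"
  assumes "connected (UNIV :: 'a set)"
    and "\<And>t. \<exists>c. \<forall>\<^sub>F s in at t. q s = c"
  obtains c where "\<And>t. \<forall>\<^sub>F s in at t. q s = c"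
proof -
  obtain c where c: "\<And>t. \<forall>\<^sub>F s in at t. q s = c t"
    using assms(2) by metis
  have "\<forall>\<^sub>F s in at t. c s = c t" for t
  proof -
    obtain S where S: "open S" "t \<in> S" "\<And>s. s \<in> S \<Longrightarrow> s \<noteq> t \<Longrightarrow> q s = c t"
      using c[of t] by (auto simp: eventually_at_topological)
    have "c s = c t" if "s \<in> S" "s \<noteq> t" for s
    proof -
      have "\<forall>\<^sub>F r in at s. q r = c t"
        unfolding eventually_at_topological
        \<comment> \<open>\<open>t\<close> is removed since nothing is known about
          \<open>q t\<close>; the T1 property keeps the set open.\<close>
        using S that by (intro exI[of _ "S - {t}"]) (auto intro: open_Diff)
      with c[of s] have "\<forall>\<^sub>F r in at s. c s = c t"
        by eventually_elim simp
      \<comment> \<open>In a perfect space \<open>at s\<close> is nontrivial, so an eventually true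
        statement that does not mention \<open>r\<close> is true.\<close>
      then show ?thesis
        by simp
    qed
    then show ?thesis
      using S by (auto simp: eventually_at_topological)
  qed
  then have "c s = c t" for s t
    using connected_local_const[OF assms(1), of s t c] by (simp add: eq_commute)
  then show ?thesis
    using that c by metis
qed

section \<open>Conservation laws of a single collision\<close>

definition kinetic_energy :: "real \<Rightarrow> real \<Rightarrow> real^3 \<Rightarrow> real^3 \<Rightarrow> real" where
  "kinetic_energy m R u w = 1/2 * m * (u \<bullet> u) + 1/2 * moment_of_inertia m R * (w \<bullet> w)"

lemma no_slip_collision_contact_velocity:
  assumes "no_slip_collision m R \<nu> u w u' w'"
  shows "contact_velocity R \<nu> u' w' = - contact_velocity R \<nu> u w"
  using assms by (auto simp: no_slip_collision_def no_slip_impulse_def)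

text \<open>The rotational part of the contact velocity is orthogonal to \<open>\<nu>\<close>, so
  reversing the contact velocity reverses the normal component of \<open>u\<close>.\<close>

lemma no_slip_collision_normal_velocity:
  assumes "no_slip_collision m R \<nu> u w u' w'"
  shows "\<nu> \<bullet> u' = - (\<nu> \<bullet> u)"
proof -
  have "\<nu> \<bullet> contact_velocity R \<nu> u w = \<nu> \<bullet> u" for u w
    by (simp add: contact_velocity_def inner_add_right inner_diff_right cross_minus_right cross_mult_right dot_cross_self)
  then show ?thesis
    using no_slip_collision_contact_velocity[OF assms] by (metis inner_minus_right)
qed

text \<open>The gain in kinetic energy is the work \<open>J \<bullet> (c + c') / 2\<close> of the impulse at the contact point.\<close>

lemma no_slip_collision_kinetic_energy:
  assumes "m \<noteq> 0" and "no_slip_collision m R \<nu> u w u' w'"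
  shows "kinetic_energy m R u' w' = kinetic_energy m R u w"
proof -
  obtain J where J: "u' = u + (1/m) *\<^sub>R J"
    "moment_of_inertia m R *\<^sub>R (w' - w) = cross3 (- (R *\<^sub>R \<nu>)) J"
    "contact_velocity R \<nu> u' w' = - contact_velocity R \<nu> u w"
    using assms by (auto simp: no_slip_collision_def no_slip_impulse_def)
  have *: "k * (y \<bullet> y) - k * (z \<bullet> z) = (k *\<^sub>R (y - z)) \<bullet> (y + z)" for k and y z :: "real^3"
    by (simp add: inner_add_right inner_diff_left inner_commute algebra_simps)
  have "2 * (kinetic_energy m R u' w' - kinetic_energy m R u w)
      = (m *\<^sub>R (u' - u)) \<bullet> (u' + u) + (moment_of_inertia m R *\<^sub>R (w' - w)) \<bullet> (w' + w)"
    unfolding *[symmetric] kinetic_energy_def by (simp add: field_simps)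
  also have "m *\<^sub>R (u' - u) = J"
    using J(1) assms(1) by simp
  also have "J \<bullet> (u' + u) + (moment_of_inertia m R *\<^sub>R (w' - w)) \<bullet> (w' + w)
      = J \<bullet> (u' + u + cross3 (w' + w) (- (R *\<^sub>R \<nu>)))"
    unfolding J(2) by (metis cross_triple inner_add_right inner_commute)
  also have "u' + u + cross3 (w' + w) (- (R *\<^sub>R \<nu>)) = 0"
    using J(3) by (simp add: contact_velocity_def cross_add_left algebra_simps add_eq_0_iff)
  finally show ?thesis
    by simp
qed

section \<open>The conserved quantity\<close>

text \<open>The squared normal velocity and the energy are bundled with the conserved vector so that
  the local constancy argument runs once for all three; the final bound uses each of them.\<close>

definition orbit_invariant ::
  "real \<Rightarrow> real \<Rightarrow> real^3 \<Rightarrow> real \<Rightarrow> real \<Rightarrow> real^3 \<Rightarrow> real^3 \<Rightarrow> real^3 \<Rightarrow> real \<times> real \<times> (real^3)" where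
  "orbit_invariant m R n a b x u w =
     ((n \<bullet> u)\<^sup>2, kinetic_energy m R u w,
      (n \<bullet> u)\<^sup>2 *\<^sub>R x - (n \<bullet> u) *\<^sub>R ((n \<bullet> x - (a + b) / 2) *\<^sub>R u
        - ((b - a - 2 * R) / 2 * R) *\<^sub>R cross3 n w))"

text \<open>With \<open>v = n \<bullet> u\<close>, the first term of the vector grows by
  \<open>s v v u\<close>. The height grows by \<open>s v\<close>, so the subtracted term grows by
  the same amount.\<close>

lemma orbit_invariant_free_motion:
  "orbit_invariant m R n a b (x + s *\<^sub>R u) u w = orbit_invariant m R n a b x u w"
  by (simp add: orbit_invariant_def inner_add_right algebra_simps power2_eq_square)

text \<open>At this wall the bracket multiplied by \<open>n \<bullet> u\<close> is a scalar multiple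
  of the contact velocity. Both factors change sign, so their product is unchanged.\<close>

lemma orbit_invariant_lower_collision:
  assumes "m \<noteq> 0" "norm n = 1" and col: "no_slip_collision m R n u w u' w'"
    and "touches R n (plane n a) x"
  shows "orbit_invariant m R n a b x u' w' = orbit_invariant m R n a b x u w"
proof -
  have "n \<bullet> n = 1"
    using assms(2) by (simp add: dot_square_norm)
  then have h: "n \<bullet> x = a + R"
    using assms(4) by (simp add: touches_def plane_def inner_diff_right)
  have "(n \<bullet> x - (a + b) / 2) *\<^sub>R y - ((b - a - 2 * R) / 2 * R) *\<^sub>R cross3 n z
      = - ((b - a - 2 * R) / 2) *\<^sub>R contact_velocity R n y z" for y z
  proof -
    have "contact_velocity R n y z = y + R *\<^sub>R cross3 n z"
      using cross_skew[of z n] by (simp add: contact_velocity_def cross_minus_right cross_mult_right)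
    moreover have "n \<bullet> x - (a + b) / 2 = - ((b - a - 2 * R) / 2)"
      using h by (simp add: field_simps)
    ultimately show ?thesis
      by (simp add: scaleR_right_distrib)
  qed
  then show ?thesis
    using no_slip_collision_normal_velocity[OF col] no_slip_collision_contact_velocity[OF col]
      no_slip_collision_kinetic_energy[OF assms(1) col]
    by (simp add: orbit_invariant_def)
qed

text \<open>Here both the height and the wall normal have the opposite sign, so the same bracket is
  again a multiple of the contact velocity, now the one taken with normal
  \<open>- n\<close>.\<close>

lemma orbit_invariant_upper_collision:
  assumes "m \<noteq> 0" "norm n = 1" and col: "no_slip_collision m R (- n) u w u' w'"
    and "touches R (- n) (plane n b) x"
  shows "orbit_invariant m R n a b x u' w' = orbit_invariant m R n a b x u w"
proof -
  have "n \<bullet> n = 1"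
    using assms(2) by (simp add: dot_square_norm)
  then have h: "n \<bullet> x = b - R"
    using assms(4) by (simp add: touches_def plane_def inner_add_right)
  have "(n \<bullet> x - (a + b) / 2) *\<^sub>R y - ((b - a - 2 * R) / 2 * R) *\<^sub>R cross3 n z
      = ((b - a - 2 * R) / 2) *\<^sub>R contact_velocity R (- n) y z" for y z
  proof -
    have "contact_velocity R (- n) y z = y - R *\<^sub>R cross3 n z"
      using cross_skew[of z n] by (simp add: contact_velocity_def cross_minus_right cross_mult_right)
    moreover have "n \<bullet> x - (a + b) / 2 = (b - a - 2 * R) / 2"
      using h by (simp add: field_simps)
    ultimately show ?thesis
      by (simp add: scaleR_right_diff_distrib)
  qed
  moreover have "n \<bullet> u' = - (n \<bullet> u)"
    using no_slip_collision_normal_velocity[OF col] by simp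
  ultimately show ?thesis
    using no_slip_collision_contact_velocity[OF col]
      no_slip_collision_kinetic_energy[OF assms(1) col]
    by (simp add: orbit_invariant_def)
qed

section \<open>Conservation along an orbit\<close>

lemma free_motion_at_orbit_invariant:
  assumes "free_motion_at x u w t"
  shows "\<forall>\<^sub>F s in nhds t.
    orbit_invariant m R n a b (x s) (u s) (w s) = orbit_invariant m R n a b (x t) (u t) (w t)"
  using assms unfolding free_motion_at_def
  by eventually_elim (simp add: orbit_invariant_free_motion)

text \<open>Free motion carries the quantity on either side of \<open>t\<close> to the position
  \<open>x t\<close>, where \<open>inv\<close> compares the incoming with the outgoing
  velocities.\<close>

lemma collision_at_orbit_invariant:
  assumes "collision_at m R \<nu> x u w t"
    and inv: "\<And>u1 w1 u2 w2. no_slip_collision m R \<nu> u1 w1 u2 w2 \<Longrightarrow>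
      orbit_invariant m R n a b (x t) u2 w2 = orbit_invariant m R n a b (x t) u1 w1"
  shows "\<exists>c. \<forall>\<^sub>F s in at t. orbit_invariant m R n a b (x s) (u s) (w s) = c"
proof -
  obtain u1 w1 u2 w2 where
    l: "\<forall>\<^sub>F s in at_left t. u s = u1 \<and> w s = w1 \<and> x s = x t + (s - t) *\<^sub>R u1" and
    r: "\<forall>\<^sub>F s in at_right t. u s = u2 \<and> w s = w2 \<and> x s = x t + (s - t) *\<^sub>R u2" and
    col: "no_slip_collision m R \<nu> u1 w1 u2 w2"
    using assms(1) by (auto simp: collision_at_def)
  have "\<forall>\<^sub>F s in at_left t. orbit_invariant m R n a b (x s) (u s) (w s)
      = orbit_invariant m R n a b (x t) u1 w1"
    using l by eventually_elim (simp add: orbit_invariant_free_motion)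
  moreover have "\<forall>\<^sub>F s in at_right t. orbit_invariant m R n a b (x s) (u s) (w s)
      = orbit_invariant m R n a b (x t) u1 w1"
    using r by eventually_elim (simp add: orbit_invariant_free_motion inv[OF col])
  ultimately show ?thesis
    unfolding eventually_at_split by blast
qed

lemma free_motion_at_continuous_left:
  assumes "free_motion_at x u w t"
  shows "(x \<longlongrightarrow> x t) (at_left t)"
proof -
  have "((\<lambda>s. x t + (s - t) *\<^sub>R u t) \<longlongrightarrow> x t + (t - t) *\<^sub>R u t) (at_left t)"
    by (intro tendsto_intros)
  moreover have "\<forall>\<^sub>F s in at_left t. x t + (s - t) *\<^sub>R u t = x s"
    using assms by (auto simp: free_motion_at_def eventually_at_filter elim: eventually_mono)
  ultimately show ?thesis
    using Lim_transform_eventually by fastforce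
qed

lemma collision_at_continuous_left:
  assumes "collision_at m R \<nu> x u w t"
  shows "(x \<longlongrightarrow> x t) (at_left t)"
proof -
  obtain u1 where u1: "\<forall>\<^sub>F s in at_left t. x t + (s - t) *\<^sub>R u1 = x s"
    using assms by (force simp: collision_at_def elim: eventually_mono)
  have "((\<lambda>s. x t + (s - t) *\<^sub>R u1) \<longlongrightarrow> x t + (t - t) *\<^sub>R u1) (at_left t)"
    by (intro tendsto_intros)
  then show ?thesis
    using u1 Lim_transform_eventually by fastforce
qed

text \<open>This extends a bound on the position from times just before a collision to the collision
  time itself.\<close>

lemma no_slip_orbit_continuous_left:
  assumes "no_slip_orbit m R n a b x u w"
  shows "(x \<longlongrightarrow> x t) (at_left t)"
  using assms free_motion_at_continuous_left collision_at_continuous_left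
  unfolding no_slip_orbit_def by metis

text \<open>The second conclusion gives the value at a contact-free time itself, which ties
  \<open>c\<close> to the velocity given there.\<close>

lemma no_slip_orbit_invariant:
  assumes "m \<noteq> 0" "norm n = 1" and orbit: "no_slip_orbit m R n a b x u w"
  obtains c where "\<And>t. \<forall>\<^sub>F s in at t. orbit_invariant m R n a b (x s) (u s) (w s) = c"
    and "\<And>t. \<not> touches R n (plane n a) (x t) \<Longrightarrow> \<not> touches R (- n) (plane n b) (x t) \<Longrightarrow>
      orbit_invariant m R n a b (x t) (u t) (w t) = c"
proof -
  have "\<exists>c. \<forall>\<^sub>F s in at t. orbit_invariant m R n a b (x s) (u s) (w s) = c" for t
  proof (cases "touches R n (plane n a) (x t)")
    case True
    with orbit have "collision_at m R n x u w t"
      by (auto simp: no_slip_orbit_def)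
    then show ?thesis
      using True assms orbit_invariant_lower_collision by (blast intro: collision_at_orbit_invariant)
  next
    case nlow: False
    show ?thesis
    proof (cases "touches R (- n) (plane n b) (x t)")
      case True
      with orbit have "collision_at m R (- n) x u w t"
        by (auto simp: no_slip_orbit_def)
      then show ?thesis
        using True assms orbit_invariant_upper_collision by (blast intro: collision_at_orbit_invariant)
    next
      case False
      with nlow orbit have "free_motion_at x u w t"
        by (auto simp: no_slip_orbit_def)
      then show ?thesis
        using free_motion_at_orbit_invariant eventually_nhds_conv_at by blast
    qed
  qed
  then obtain c where
    c: "\<And>t. \<forall>\<^sub>F s in at t. orbit_invariant m R n a b (x s) (u s) (w s) = c"
    using locally_constant_off_points_imp_constant
      [OF connected_UNIV, of "\<lambda>s. orbit_invariant m R n a b (x s) (u s) (w s)"] by blast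
  have "orbit_invariant m R n a b (x t) (u t) (w t) = c"
    if "\<not> touches R n (plane n a) (x t)" "\<not> touches R (- n) (plane n b) (x t)" for t
  proof -
    have "free_motion_at x u w t"
      using that orbit by (auto simp: no_slip_orbit_def)
    then have "\<forall>\<^sub>F s in at t. orbit_invariant m R n a b (x s) (u s) (w s)
        = orbit_invariant m R n a b (x t) (u t) (w t)"
      using free_motion_at_orbit_invariant eventually_nhds_conv_at by blast
    with c[of t] have "\<forall>\<^sub>F s in at t. orbit_invariant m R n a b (x t) (u t) (w t) = c"
      by eventually_elim simp
    then show ?thesis
      by simp
  qed
  with c show ?thesis
    using that by blast
qed

section \<open>Bounding the position\<close>

text \<open>Both parts of the energy are nonnegative, so each is at most the total; the constants 2
  and 5 come from the coefficients 1/2 and 1/5 in the energy.\<close>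

lemma kinetic_energy_bounds:
  assumes "m > 0" "R > 0"
  shows "norm u \<le> sqrt (2 * kinetic_energy m R u w / m)"
    and "R * norm w \<le> sqrt (5 * kinetic_energy m R u w / m)"
proof -
  have "2 * kinetic_energy m R u w / m = (norm u)\<^sup>2 + 2/5 * (R * norm w)\<^sup>2"
    using assms by (simp add: kinetic_energy_def moment_of_inertia_def dot_square_norm
        field_simps power2_eq_square)
  then have "(norm u)\<^sup>2 \<le> 2 * kinetic_energy m R u w / m"
    by simp
  moreover have "5 * kinetic_energy m R u w / m = 5/2 * (norm u)\<^sup>2 + (R * norm w)\<^sup>2"
    using assms by (simp add: kinetic_energy_def moment_of_inertia_def dot_square_norm
        field_simps power2_eq_square)
  then have "(R * norm w)\<^sup>2 \<le> 5 * kinetic_energy m R u w / m"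
    by simp
  ultimately show "norm u \<le> sqrt (2 * kinetic_energy m R u w / m)"
    and "R * norm w \<le> sqrt (5 * kinetic_energy m R u w / m)"
    by (simp_all only: real_le_rsqrt)
qed

lemma norm_cross3_le: "norm (cross3 y z) \<le> norm y * norm z"
  by (rule power2_le_imp_le) (simp_all add: norm_cross power_mult_distrib)

text \<open>Solving the vector component for \<open>x\<close> leaves terms controlled by the energy
  and the distance of the walls, hence a bound in terms of the invariant and fixed data
  only.\<close>

lemma orbit_invariant_bound:
  assumes "m > 0" "R > 0" "norm n = 1"
    and inv: "orbit_invariant m R n a b x u w = (V, E, Q)" and "V \<noteq> 0"
    and h: "a \<le> n \<bullet> x" "n \<bullet> x \<le> b"
  shows "norm x \<le> (norm Q + sqrt V * ((b - a) * sqrt (2 * E / m)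
    + \<bar>b - a - 2 * R\<bar> / 2 * sqrt (5 * E / m))) / V"
proof -
  define y where "y = (n \<bullet> x - (a + b) / 2) *\<^sub>R u - ((b - a - 2 * R) / 2 * R) *\<^sub>R cross3 n w"
  have V: "V = (n \<bullet> u)\<^sup>2" and E: "E = kinetic_energy m R u w"
    and Q: "Q = V *\<^sub>R x - (n \<bullet> u) *\<^sub>R y"
    using inv by (auto simp: orbit_invariant_def y_def)
  have "V > 0"
    using V \<open>V \<noteq> 0\<close> by simp
  have "norm y \<le> \<bar>n \<bullet> x - (a + b) / 2\<bar> * norm u + \<bar>b - a - 2 * R\<bar> / 2 * (R * norm (cross3 n w))"
    unfolding y_def using \<open>R > 0\<close>
    by (intro order_trans[OF norm_triangle_ineq4]) (simp add: abs_mult)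
  also have "\<dots> \<le> (b - a) * sqrt (2 * E / m) + \<bar>b - a - 2 * R\<bar> / 2 * sqrt (5 * E / m)"
  proof (intro add_mono mult_mono)
    \<comment> \<open>A crude estimate: half of \<open>b - a\<close> already bounds the left
      side.\<close>
    show "\<bar>n \<bullet> x - (a + b) / 2\<bar> \<le> b - a"
      using h by (simp add: abs_le_iff field_simps)
    show "R * norm (cross3 n w) \<le> sqrt (5 * E / m)"
    proof -
      have "R * norm (cross3 n w) \<le> R * norm w"
        using norm_cross3_le[of n w] assms(2,3) by simp
      also have "\<dots> \<le> sqrt (5 * E / m)"
        unfolding E by (rule kinetic_energy_bounds(2)[OF assms(1,2)])
      finally show ?thesis .
    qed
    show "norm u \<le> sqrt (2 * E / m)"
      unfolding E by (rule kinetic_energy_bounds(1)[OF assms(1,2)])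
  qed (use h assms(2) in simp_all)
  finally have y: "norm y \<le> (b - a) * sqrt (2 * E / m) + \<bar>b - a - 2 * R\<bar> / 2 * sqrt (5 * E / m)" .
  have "V * norm x = norm (Q + (n \<bullet> u) *\<^sub>R y)"
    using Q \<open>V > 0\<close> by simp
  also have "\<dots> \<le> norm Q + sqrt V * norm y"
    using norm_triangle_ineq[of Q "(n \<bullet> u) *\<^sub>R y"] by (simp add: V)
  also have "\<dots> \<le> norm Q + sqrt V * ((b - a) * sqrt (2 * E / m)
    + \<bar>b - a - 2 * R\<bar> / 2 * sqrt (5 * E / m))"
    using y \<open>V > 0\<close> by (intro add_left_mono mult_left_mono) auto
  finally show ?thesis
    using \<open>V > 0\<close> by (simp add: field_simps)
qed

theorem proposition2p2:
  fixes m R a b :: real and n :: "real^3" and x u w :: "real \<Rightarrow> real^3"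
  assumes "m > 0" and "R > 0"
    and "norm n = 1" and "b - a > 2 * R"
    and "no_slip_orbit m R n a b x u w"
    and "\<exists>t. \<not> touches R n (plane n a) (x t) \<and> \<not> touches R (- n) (plane n b) (x t) \<and> n \<bullet> u t \<noteq> 0"
  shows "bounded (range x)"
proof -
  have "m \<noteq> 0"
    using assms(1) by simp
  then obtain c where c: "\<And>t. \<forall>\<^sub>F s in at t. orbit_invariant m R n a b (x s) (u s) (w s) = c"
    and c_free: "\<And>t. \<not> touches R n (plane n a) (x t) \<Longrightarrow> \<not> touches R (- n) (plane n b) (x t) \<Longrightarrow>
      orbit_invariant m R n a b (x t) (u t) (w t) = c"
    by (rule no_slip_orbit_invariant[OF _ assms(3,5)]) blast
  obtain V E Q where VEQ: "c = (V, E, Q)"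
    by (metis prod_cases3)
  \<comment> \<open>At the contact-free time of the hypothesis, \<open>V\<close> is the square of
    the nonzero normal velocity.\<close>
  have "V \<noteq> 0"
    using assms(6) c_free VEQ by (auto simp: orbit_invariant_def)
  have h: "a \<le> n \<bullet> x t" "n \<bullet> x t \<le> b" for t
  proof -
    have "x t \<in> cball (x t) R"
      using assms(2) by simp
    also have "\<dots> \<subseteq> region_between n a b"
      using assms(5) by (simp only: no_slip_orbit_def)
    finally have "x t \<in> region_between n a b" .
    then show "a \<le> n \<bullet> x t" "n \<bullet> x t \<le> b"
      by (auto simp: region_between_def)
  qed
  define B where "B = (norm Q + sqrt V * ((b - a) * sqrt (2 * E / m)
    + \<bar>b - a - 2 * R\<bar> / 2 * sqrt (5 * E / m))) / V"
  \<comment> \<open>At a collision time \<open>u t\<close> and \<open>w t\<close> carry no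
    information, so the bound is proved just before \<open>t\<close> and passed to the left
    limit.\<close>
  have "norm (x t) \<le> B" for t
  proof (rule tendsto_upperbound)
    show "((\<lambda>s. norm (x s)) \<longlongrightarrow> norm (x t)) (at_left t)"
      using no_slip_orbit_continuous_left[OF assms(5)] by (rule tendsto_norm)
    have "\<forall>\<^sub>F s in at_left t. orbit_invariant m R n a b (x s) (u s) (w s) = c"
      using c[of t] by (simp add: eventually_at_split)
    then show "\<forall>\<^sub>F s in at_left t. norm (x s) \<le> B"
      unfolding B_def
      by eventually_elim (rule orbit_invariant_bound[OF assms(1-3) _ \<open>V \<noteq> 0\<close> h], simp add: VEQ)
  qed simp
  then show ?thesis
    by (auto simp: bounded_iff)
qed

end
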